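(* Any tournament $H$ with $\beta(H)\le 2$ satisfies $t(T_n,H)=O(n)$ as $n\to\infty$ (with $H$ fixed).
   Context: A tournament is a digraph having exactly one of the edges $(u,v),(v,u)$ for every pair of distinct vertices $u,v$. $T_n$ is the transitive (acyclic) tournament on $n$ vertices. For a linear order of the vertices of a tournament $H$, an edge $(i,j)$ of $H$ is a back edge if $j$ appears before $i$ in the order. The set of back edges of a given ordering, viewed as an undirected graph on $V(H)$, is a back-edge graph of $H$. $\beta(H)$ (the minimum feedback edge set number) is the smallest number of edges in a back-edge graph of $H$, over all orderings. Adding an edge to a tournament means adding the reverse $(v,u)$ of some existing edge $(u,v)$. A digraph contains a copy of $H$ if it has a (not necessarily induced) subgraph isomorphic to $H$. For $n\ge |V(H)|$, $t(T_n,H)$ is the smallest integer $t$ such that adding any $t$ edges to $T_n$ results in a digraph containing a copy of $H$. *)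

theory Defs
  imports "Graph_Theory.Graph_Theory" "HOL-Library.Landau_Symbols"
begin

definition tournament :: "'a pair_pre_digraph \<Rightarrow> bool" where
  "tournament H \<longleftrightarrow> pair_digraph H \<and>
     (\<forall>u\<in>pverts H. \<forall>v\<in>pverts H. u \<noteq> v \<longrightarrow> ((u, v) \<in> parcs H) \<noteq> ((v, u) \<in> parcs H))"

definition transitive_tournament :: "nat \<Rightarrow> nat pair_pre_digraph" where
  "transitive_tournament n = \<lparr>pverts = {..<n}, parcs = {(i, j). i < j \<and> j < n}\<rparr>"

text \<open>
  The order \<open>r\<close> is reflexive, and \<open>(j, i) \<in> r\<close> means that \<open>j\<close> appears before or equals \<open>i\<close>;
  equality is impossible on an arc since tournaments are loop-free.
\<close>

definition back_edges :: "'a pair_pre_digraph \<Rightarrow> 'a rel \<Rightarrow> ('a \<times> 'a) set" where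
  "back_edges H r = {(i, j) \<in> parcs H. (j, i) \<in> r}"

text \<open>The back-edge graph has vertex set \<open>pverts H\<close>; it is given by its set of undirected edges.\<close>

definition back_edge_graph :: "'a pair_pre_digraph \<Rightarrow> 'a rel \<Rightarrow> 'a set set" where
  "back_edge_graph H r = (\<lambda>(i, j). {i, j}) ` back_edges H r"

definition min_feedback :: "'a pair_pre_digraph \<Rightarrow> nat" where
  "min_feedback H =
     (LEAST k. \<exists>r. linear_order_on (pverts H) r \<and> card (back_edge_graph H r) = k)"

definition contains_copy :: "('a, 'b) pre_digraph \<Rightarrow> ('c, 'd) pre_digraph \<Rightarrow> bool" where
  "contains_copy D H \<longleftrightarrow> (\<exists>K. subgraph K D \<and> digraph_iso H K)"

text \<open>The arcs of \<open>S\<close> themselves are kept, so each pair in \<open>S\<close> becomes bidirected.\<close>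

definition add_reverses :: "'a pair_pre_digraph \<Rightarrow> ('a \<times> 'a) set \<Rightarrow> 'a pair_pre_digraph" where
  "add_reverses G S = \<lparr>pverts = pverts G, parcs = parcs G \<union> S\<inverse>\<rparr>"

text \<open>
  The least number is attained whenever \<open>T\<close> is a tournament with at least as many vertices as
  the tournament \<open>H\<close>, because adding all reverses turns \<open>T\<close> into a complete digraph.
\<close>

definition edge_adding_number :: "'a pair_pre_digraph \<Rightarrow> 'b pair_pre_digraph \<Rightarrow> nat" where
  "edge_adding_number T H =
     (LEAST t. \<forall>S \<subseteq> parcs T. card S = t \<longrightarrow> contains_copy (add_reverses T S) H)"

lemma tournament_transitive_tournament: "tournament (transitive_tournament n)"
proof -
  have "parcs (transitive_tournament n) \<subseteq> {..<n} \<times> {..<n}"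
    by (auto simp: transitive_tournament_def)
  then have "finite (parcs (transitive_tournament n))"
    by (rule finite_subset) simp
  then show ?thesis
    unfolding tournament_def
    by (intro conjI) (unfold_locales, auto simp: transitive_tournament_def)
qed

lemma acyclic_transitive_tournament: "acyclic (parcs (transitive_tournament n))"
  by (rule acyclic_subset[OF wf_acyclic[OF wf_less]]) (auto simp: transitive_tournament_def)

lemma contains_copy_iff:
  fixes D :: "'a pair_pre_digraph" and H :: "'b pair_pre_digraph"
  assumes "pair_wf_digraph D" and "pair_wf_digraph H"
  shows "contains_copy D H \<longleftrightarrow>
    (\<exists>f. inj_on f (pverts H) \<and> f ` pverts H \<subseteq> pverts D \<and>
         (\<forall>u v. (u, v) \<in> parcs H \<longrightarrow> (f u, f v) \<in> parcs D))"
    (is "_ \<longleftrightarrow> (\<exists>f. ?emb f)")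
proof
  assume "contains_copy D H"
  then obtain h where sub: "subgraph (app_iso h H) D"
    and iso: "pre_digraph.digraph_isomorphism H h"
    unfolding contains_copy_def digraph_iso_def by blast
  have "(iso_verts h u, iso_verts h v) \<in> parcs D" if uv: "(u, v) \<in> parcs H" for u v
  proof -
    have "iso_arcs h ` parcs H \<subseteq> parcs D" and hd: "iso_tail h = fst" "iso_head h = snd"
      using sub by (simp_all add: subgraph_def compatible_def)
    then have "iso_arcs h (u, v) \<in> parcs D"
      using uv by blast
    moreover have "\<forall>a\<in>parcs H. iso_verts h (fst a) = fst (iso_arcs h a) \<and>
        iso_verts h (snd a) = snd (iso_arcs h a)"
      using iso hd by (simp add: pre_digraph.digraph_isomorphism_def)
    ultimately show ?thesis using uv by fastforce
  qed
  moreover have "inj_on (iso_verts h) (pverts H)"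
    using iso by (simp add: pre_digraph.digraph_isomorphism_def)
  moreover have "iso_verts h ` pverts H \<subseteq> pverts D"
    using sub by (simp add: subgraph_def)
  ultimately have "?emb (iso_verts h)" by blast
  then show "\<exists>f. ?emb f" by (rule exI[of ?emb])
next
  interpret D: pair_wf_digraph D by fact
  interpret H: pair_wf_digraph H by fact
  assume "\<exists>f. ?emb f"
  then obtain f where f: "inj_on f (pverts H)" "f ` pverts H \<subseteq> pverts D"
    "\<And>u v. (u, v) \<in> parcs H \<Longrightarrow> (f u, f v) \<in> parcs D" by blast
  define h where "h = \<lparr>iso_verts = f, iso_arcs = map_prod f f,
    iso_head = snd :: 'a \<times> 'a \<Rightarrow> 'a, iso_tail = fst\<rparr>"
  have "parcs H \<subseteq> pverts H \<times> pverts H"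
    by (auto dest: H.wellformed')
  then have "inj_on (map_prod f f) (parcs H)"
    using map_prod_inj_on[OF f(1) f(1)] by (rule inj_on_subset[rotated])
  then have iso: "pre_digraph.digraph_isomorphism H h"
    using f(1) H.wf_digraph_axioms by (simp add: pre_digraph.digraph_isomorphism_def h_def)
  have "map_prod f f ` parcs H \<subseteq> parcs D"
    using f(3) by auto
  then have "subgraph (app_iso h H) D"
    using f(2) D.wf_digraph_axioms wf_digraph.wf_digraphI_app_iso[OF H.wf_digraph_axioms iso]
    by (simp add: subgraph_def compatible_def h_def)
  with iso show "contains_copy D H"
    unfolding contains_copy_def digraph_iso_def by blast
qed

end

theory Submission
  imports Defs "HOL-Library.Infinite_Set"
begin

text \<open>
  Linearly many reversed arcs already force one small configuration that serves every tournament
  whose back-edge graph has at most two edges.  View the reversed arcs as a graph \<open>S\<close> on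
  \<open>{..<n}\<close>.  Discarding from every vertex a bounded number of extreme incident edges
  costs only \<open>O(n)\<close> edges, so a surviving edge \<open>xy\<close> with \<open>x < y\<close> has many discarded edges beside it:
  \<open>x\<close> has many neighbours beyond \<open>y\<close>, and \<open>y\<close> has many neighbours both below \<open>x\<close> and between \<open>x\<close>
  and \<open>y\<close>.  Thinning these out leaves neighbours \<open>u < x < w < y\<close> of \<open>y\<close> and
  neighbours \<open>z 0 < z 1 < \<dots>\<close> of \<open>x\<close> beyond \<open>y\<close> with all gaps at least \<open>h = |V(H)|\<close>
  (\<open>ex_spread_double_star\<close>).  The gaps leave room for the vertices of \<open>H\<close> without back edges.

  Number the vertices of \<open>H\<close> along an optimal order.  Two back edges that share an end on the
  same side, cross or are nested occur verbatim in the configuration, and \<open>H\<close> embeds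
  monotonically.  Two remaining patterns cannot be found this way, because \<open>S\<close> may be bipartite
  between the lower and the upper half of \<open>{..<n}\<close>: the path \<open>a < b < d\<close> with back edges
  \<open>ab\<close>, \<open>bd\<close>, and the separated pair \<open>a < b < c < d\<close> with back edges \<open>ab\<close>, \<open>cd\<close>.  For
  these the order is changed by moving one end of a back edge to an earlier place.  Every vertex
  that it jumps over becomes joined to it by a back edge, unless it was so before; but all new
  back edges share this one vertex, and placing it at \<open>x\<close> turns them into edges from \<open>x\<close> to \<open>y\<close>
  and to the leaves \<open>z i\<close> (\<open>pattern_embedding_shift\<close>).
\<close>

section \<open>A spread double star in a graph with linearly many edges\<close>

text \<open>Taking every \<open>g\<close>-th element of a set of integers makes consecutive choices differ by at
  least \<open>g\<close>; stopping early enough at both ends also keeps them away from the borders.\<close>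

lemma ex_spread_sequence:
  fixes A :: "nat set"
  assumes A: "A \<subseteq> {p..<q}" and card: "g * Suc k \<le> card A" and g: "0 < g"
  shows "\<exists>z. (\<forall>i<k. z i \<in> A \<and> p + g \<le> z i \<and> z i + g \<le> q) \<and>
    (\<forall>j<k. \<forall>i<j. z i + g \<le> z j)"
proof -
  have fin: "finite A"
    using A finite_subset by blast
  obtain e where mono: "strict_mono_on {..<card A} e" and e: "\<And>m. m < card A \<Longrightarrow> e m \<in> A"
    using finite_enumerate[OF fin] by blast
  have step: "e a + d \<le> e (a + d)" if "a + d < card A" for a d
    using that
  proof (induction d)
    case (Suc d)
    then have "e (a + d) < e (a + Suc d)"
      by (intro strict_mono_onD[OF mono]) auto
    with Suc show ?case by simp
  qed simp
  define z where "z i = e (g * Suc i)" for i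
  have idx: "g * Suc i + g \<le> card A" if "i < k" for i
  proof -
    have "g * Suc (Suc i) \<le> g * Suc k"
      using that by (intro mult_le_mono) auto
    with card show ?thesis by simp
  qed
  have "z i \<in> A \<and> p + g \<le> z i \<and> z i + g \<le> q" if i: "i < k" for i
  proof (intro conjI)
    show "z i \<in> A"
      unfolding z_def using idx[OF i] g by (intro e) simp
    have "e 0 + g * Suc i \<le> e (0 + g * Suc i)"
      using idx[OF i] g by (intro step) simp
    moreover have "p \<le> e 0"
      using e[of 0] A idx[OF i] g by force
    ultimately show "p + g \<le> z i"
      by (simp add: z_def)
    have "e (g * Suc i) + (g - 1) \<le> e (g * Suc i + (g - 1))"
      using idx[OF i] g by (intro step) simp
    moreover have "e (g * Suc i + (g - 1)) < q"
      using e[of "g * Suc i + (g - 1)"] A idx[OF i] g by force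
    ultimately show "z i + g \<le> q"
      unfolding z_def using g by linarith
  qed
  moreover have "z i + g \<le> z j" if "j < k" "i < j" for i j
  proof -
    obtain d where d: "j = Suc (i + d)"
      using \<open>i < j\<close> less_imp_Suc_add by blast
    have j: "g * Suc j = g * Suc i + (g + g * d)"
      by (simp add: d algebra_simps)
    have "e (g * Suc i) + (g + g * d) \<le> e (g * Suc i + (g + g * d))"
      using idx[OF \<open>j < k\<close>] g unfolding j by (intro step) simp
    then show ?thesis
      unfolding z_def j by linarith
  qed
  ultimately show ?thesis by blast
qed

text \<open>The smallest element of the set on the left has all its other elements above it.\<close>

lemma card_few_above:
  fixes A :: "nat set"
  assumes "finite A"
  shows "card {a \<in> A. card {b \<in> A. a < b} < k} \<le> k"
proof (rule ccontr)
  let ?B = "{a \<in> A. card {b \<in> A. a < b} < k}"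
  assume "\<not> card ?B \<le> k"
  then have k: "k < card ?B" by simp
  then have "?B \<noteq> {}" by (metis card.empty not_less_zero)
  have fin: "finite ?B" using assms by simp
  have "Min ?B \<in> ?B" using fin \<open>?B \<noteq> {}\<close> by (rule Min_in)
  have "?B - {Min ?B} \<subseteq> {b \<in> A. Min ?B < b}"
    using fin by (auto simp: order_less_le)
  then have "card (?B - {Min ?B}) \<le> card {b \<in> A. Min ?B < b}"
    using assms by (intro card_mono) auto
  with \<open>Min ?B \<in> ?B\<close> k fin show False by auto
qed

lemma card_few_below:
  fixes A :: "nat set"
  assumes "finite A"
  shows "card {a \<in> A. card {b \<in> A. b < a} < k} \<le> k"
proof (rule ccontr)
  let ?B = "{a \<in> A. card {b \<in> A. b < a} < k}"
  assume "\<not> card ?B \<le> k"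
  then have k: "k < card ?B" by simp
  then have "?B \<noteq> {}" by (metis card.empty not_less_zero)
  have fin: "finite ?B" using assms by simp
  have "Max ?B \<in> ?B" using fin \<open>?B \<noteq> {}\<close> by (rule Max_in)
  have "?B - {Max ?B} \<subseteq> {b \<in> A. b < Max ?B}"
    using fin by (auto simp: order_less_le)
  then have "card (?B - {Max ?B}) \<le> card {b \<in> A. b < Max ?B}"
    using assms by (intro card_mono) auto
  with \<open>Max ?B \<in> ?B\<close> k fin show False by auto
qed

text \<open>
  An edge violates one of the three bounds only if it is among the \<open>k\<close> last edges going up from
  its lower end, or among the \<open>l\<close> first or \<open>l\<close> last edges going down from its upper end.
  Summed over all vertices, this accounts for at most \<open>(k + 2 * l) * n\<close> edges.
\<close>

lemma ex_central_edge:
  fixes S :: "(nat \<times> nat) set"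
  assumes S: "S \<subseteq> {(i, j). i < j \<and> j < n}" and big: "(k + 2 * l) * n < card S"
  shows "\<exists>x y. (x, y) \<in> S \<and> k \<le> card {z. (x, z) \<in> S \<and> y < z} \<and>
    l \<le> card {u. (u, y) \<in> S \<and> u < x} \<and> l \<le> card {w. (w, y) \<in> S \<and> x < w}"
proof (rule ccontr)
  assume none: "\<not> ?thesis"
  have fin_right: "finite {z. (x, z) \<in> S}" for x
    by (rule finite_subset[of _ "{..<n}"]) (use S in auto)
  have fin_left: "finite {u. (u, y) \<in> S}" for y
    by (rule finite_subset[of _ "{..<y}"]) (use S in auto)
  define R where "R x = {y. (x, y) \<in> S \<and> card {z. (x, z) \<in> S \<and> y < z} < k}" for x
  define L where "L y = {x. (x, y) \<in> S \<and> card {u. (u, y) \<in> S \<and> u < x} < l}" for y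
  define M where "M y = {x. (x, y) \<in> S \<and> card {w. (w, y) \<in> S \<and> x < w} < l}" for y
  have R: "card (R x) \<le> k" "finite (R x)" for x
    using card_few_above[OF fin_right[of x], of k] fin_right[of x] by (auto simp: R_def)
  have L: "card (L y) \<le> l" "finite (L y)" for y
    using card_few_below[OF fin_left[of y], of l] fin_left[of y] by (auto simp: L_def)
  have M: "card (M y) \<le> l" "finite (M y)" for y
    using card_few_above[OF fin_left[of y], of l] fin_left[of y] by (auto simp: M_def)
  have sum_le: "card (Sigma {..<n} F) \<le> c * n"
    if "\<And>i. card (F i) \<le> c" "\<And>i. finite (F i)" for F :: "nat \<Rightarrow> nat set" and c
  proof -
    have "card (Sigma {..<n} F) = (\<Sum>i<n. card (F i))"
      using that by (simp add: card_SigmaI)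
    also have "\<dots> \<le> of_nat (card {..<n}) * c"
      using that by (intro sum_bounded_above)
    finally show ?thesis by (simp add: mult.commute)
  qed
  have "S \<subseteq> Sigma {..<n} R \<union> (Sigma {..<n} L)\<inverse> \<union> (Sigma {..<n} M)\<inverse>"
  proof
    fix e assume "e \<in> S"
    obtain x y where e: "e = (x, y)" by force
    with \<open>e \<in> S\<close> S have "(x, y) \<in> S" "x < n" "y < n" by auto
    then show "e \<in> Sigma {..<n} R \<union> (Sigma {..<n} L)\<inverse> \<union> (Sigma {..<n} M)\<inverse>"
      using none unfolding e R_def L_def M_def by (auto simp: not_le)
  qed
  then have "card S \<le> card (Sigma {..<n} R \<union> (Sigma {..<n} L)\<inverse> \<union> (Sigma {..<n} M)\<inverse>)"
    using R L M by (intro card_mono) auto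
  also have "\<dots> \<le> card (Sigma {..<n} R) + card (Sigma {..<n} L) + card (Sigma {..<n} M)"
    by (metis (no_types, lifting) card_Un_le card_inverse add_le_mono order_trans order_refl)
  also have "\<dots> \<le> k * n + l * n + l * n"
    using R L M by (intro add_mono sum_le)
  finally show False
    using big by (simp add: algebra_simps)
qed

text \<open>
  Two stars with centres \<open>x < y\<close> joined by an edge: the leaves of \<open>x\<close> are the \<open>z i\<close>, those of \<open>y\<close>
  are \<open>u\<close> and \<open>w\<close>.  Each point \<open>v\<close> is followed by a gap of at least \<open>h\<close>, so that the places
  \<open>v + i\<close> with \<open>0 < i < h\<close> are free for further vertices.
\<close>

locale spread_double_star =
  fixes h n :: nat and S :: "(nat \<times> nat) set" and u x w y :: nat and z :: "nat \<Rightarrow> nat"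
  assumes arcs: "(u, y) \<in> S" "(x, y) \<in> S" "(w, y) \<in> S" "\<And>i. i < h \<Longrightarrow> (x, z i) \<in> S"
    and gaps: "h \<le> u" "u + h \<le> x" "x + h \<le> w" "w + h \<le> y"
      "\<And>i. i < h \<Longrightarrow> y + h \<le> z i" "\<And>i. i < h \<Longrightarrow> z i + h \<le> n"
      "\<And>i j. i < j \<Longrightarrow> j < h \<Longrightarrow> z i + h \<le> z j"

lemma ex_spread_double_star:
  assumes S: "S \<subseteq> {(i, j). i < j \<and> j < n}"
    and big: "(Suc h * Suc h + 2 * (Suc h * 2)) * n < card S"
  shows "\<exists>u x w y z. spread_double_star h n S u x w y z"
proof -
  obtain x y where xy: "(x, y) \<in> S"
    and Z: "Suc h * Suc h \<le> card {z. (x, z) \<in> S \<and> y < z}"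
    and U: "Suc h * 2 \<le> card {u. (u, y) \<in> S \<and> u < x}"
    and W: "Suc h * 2 \<le> card {w. (w, y) \<in> S \<and> x < w}"
    using ex_central_edge[OF S big] by blast
  have "{z. (x, z) \<in> S \<and> y < z} \<subseteq> {y..<n}" using S by auto
  \<comment> \<open>The gap \<open>Suc h\<close> is used instead of \<open>h\<close> because thinning out needs a positive gap.\<close>
  from ex_spread_sequence[OF this Z] obtain z where
    z: "\<And>i. i < h \<Longrightarrow> (x, z i) \<in> S \<and> y + Suc h \<le> z i \<and> z i + Suc h \<le> n"
      "\<And>i j. i < j \<Longrightarrow> j < h \<Longrightarrow> z i + Suc h \<le> z j"
    by auto
  have "{u. (u, y) \<in> S \<and> u < x} \<subseteq> {0..<x}" by auto
  from ex_spread_sequence[OF this, of "Suc h" 1] U obtain u where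
    u: "(u, y) \<in> S" "Suc h \<le> u" "u + Suc h \<le> x"
    by auto
  have "{w. (w, y) \<in> S \<and> x < w} \<subseteq> {x..<y}" using S by auto
  from ex_spread_sequence[OF this, of "Suc h" 1] W obtain w where
    w: "(w, y) \<in> S" "x + Suc h \<le> w" "w + Suc h \<le> y"
    by auto
  have "spread_double_star h n S u x w y z"
    using xy z u w by unfold_locales (force | linarith)+
  then show ?thesis by blast
qed

section \<open>Embedding patterns of back edges\<close>

text \<open>
  The tournament to be embedded has vertices \<open>{..<h}\<close> and back edges \<open>B\<close>, each written with its
  smaller end first, and the host is the transitive tournament on \<open>{..<n}\<close> with the reverses of
  \<open>S\<close> added.  Since a pair of vertices may be mapped in either order, each pair
  offers two ways to realise its arc.
\<close>

definition pattern_embedding ::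
    "nat \<Rightarrow> (nat \<times> nat) set \<Rightarrow> nat \<Rightarrow> (nat \<times> nat) set \<Rightarrow> (nat \<Rightarrow> nat) \<Rightarrow> bool" where
  "pattern_embedding h B n S f \<longleftrightarrow> (\<forall>i<h. f i < n) \<and>
     (\<forall>j<h. \<forall>i<j. if (i, j) \<in> B then f j < f i \<or> (f i, f j) \<in> S
                   else f i < f j \<or> (f j, f i) \<in> S)"

lemma pattern_embedding_mono:
  assumes g: "strict_mono_on {..<h} g" and bound: "\<And>i. i < h \<Longrightarrow> g i < n"
    and B: "\<And>i j. (i, j) \<in> B \<Longrightarrow> (g i, g j) \<in> S"
  shows "pattern_embedding h B n S g"
  using bound B strict_mono_onD[OF g] by (auto simp: pattern_embedding_def)

text \<open>
  Vertex \<open>m\<close> is moved to the place \<open>p\<close> just before vertex \<open>l\<close>, the others keep their order.  The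
  back edges between \<open>m\<close> and the vertices it passes become forward, and the forward arcs
  from passed vertices into \<open>m\<close> become back edges, all of them at \<open>p\<close>.
\<close>

lemma pattern_embedding_shift:
  assumes g: "strict_mono_on {..<h} g" and bound: "\<And>i. i < h \<Longrightarrow> g i < n"
    and m: "l < m" "m < h"
    and p: "\<And>i. i < l \<Longrightarrow> g i < p" "p < g l"
    and passed: "\<And>i. l \<le> i \<Longrightarrow> i < m \<Longrightarrow> (i, m) \<notin> B \<Longrightarrow> (p, g i) \<in> S"
    and B: "\<And>i j. (i, j) \<in> B \<Longrightarrow> \<not> (l \<le> i \<and> j = m) \<Longrightarrow> ((g(m := p)) i, (g(m := p)) j) \<in> S"
  shows "pattern_embedding h B n S (g(m := p))"
proof -
  have mono: "g i < g j" if "i < j" "j < h" for i j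
    using strict_mono_onD[OF g] that by simp
  have after: "p < g i" if "l \<le> i" "i < h" for i
    using p(2) mono[of l i] that by (cases "i = l") auto
  have "(g(m := p)) i < n" if "i < h" for i
    using p(2) bound[of l] bound[of i] m that by simp
  moreover have "if (i, j) \<in> B then (g(m := p)) j < (g(m := p)) i \<or> ((g(m := p)) i, (g(m := p)) j) \<in> S
      else (g(m := p)) i < (g(m := p)) j \<or> ((g(m := p)) j, (g(m := p)) i) \<in> S"
    if ij: "i < j" "j < h" for i j
  proof (cases "l \<le> i \<and> j = m")
    case True
    then show ?thesis
      using ij after[of i] passed[of i] by auto
  next
    case False
    have "(g(m := p)) i < (g(m := p)) j"
      using False ij mono p(1)[of i] after[of j] m by auto
    with B[of i j] False show ?thesis by auto
  qed
  ultimately show ?thesis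
    unfolding pattern_embedding_def by blast
qed

context spread_double_star
begin

text \<open>
  In the embeddings below, a vertex \<open>i\<close> that meets no back edge is put at \<open>v + i\<close>, where \<open>v\<close> is the
  closest preceding point in use, at \<open>i\<close> itself if there is none, or at \<open>z i\<close>.
\<close>

lemma leaf_bounds:
  assumes "i < h"
  shows "u < x" "x < w" "w < y" "u + i < x" "x + i < w" "x + i < y" "w + i < y"
    "y < z i" "z i < n" "y < n" "i < u"
  using gaps(1-4) gaps(5,6)[OF assms] assms by linarith+

lemma leaf_less: "i < j \<Longrightarrow> j < h \<Longrightarrow> z i < z j"
  using gaps(7)[of i j] by linarith

text \<open>The case \<open>b = d\<close> covers a single back edge.\<close>

lemma embeds_star:
  assumes "a < b" "b \<le> d" "d < h"
  shows "\<exists>f. pattern_embedding h {(a, b), (a, d)} n S f"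
proof -
  define g where "g i = (if i < a then i else if i = a then x else if i < b then x + i
    else if i = b then y else z i)" for i
  have "strict_mono_on {..<h} g"
  proof (rule strict_mono_onI)
    fix i j assume "i \<in> {..<h}" "j \<in> {..<h}" "i < j"
    then show "g i < g j"
      using leaf_bounds[of i] leaf_bounds[of j] leaf_less[of i j] by (auto simp: g_def)
  qed
  moreover have "g i < n" if "i < h" for i
    using leaf_bounds[OF that] by (auto simp: g_def)
  ultimately have "pattern_embedding h {(a, b), (a, d)} n S g"
    using assms arcs(2) arcs(4)[of d] by (intro pattern_embedding_mono) (auto simp: g_def)
  then show ?thesis by blast
qed

text \<open>The case \<open>b = d\<close> is that of two back edges with a common later end.\<close>

lemma embeds_crossing:
  assumes "a < c" "c < b" "b \<le> d" "d < h"
  shows "\<exists>f. pattern_embedding h {(a, b), (c, d)} n S f"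
proof -
  define g where "g i = (if i < a then i else if i = a then u else if i < c then u + i
    else if i = c then x else if i < b then x + i else if i = b then y else z i)" for i
  have "strict_mono_on {..<h} g"
  proof (rule strict_mono_onI)
    fix i j assume "i \<in> {..<h}" "j \<in> {..<h}" "i < j"
    then show "g i < g j"
      using leaf_bounds[of i] leaf_bounds[of j] leaf_less[of i j] by (auto simp: g_def)
  qed
  moreover have "g i < n" if "i < h" for i
    using leaf_bounds[OF that] by (auto simp: g_def)
  ultimately have "pattern_embedding h {(a, b), (c, d)} n S g"
    using assms arcs(1,2) arcs(4)[of d] by (intro pattern_embedding_mono) (auto simp: g_def)
  then show ?thesis by blast
qed

lemma embeds_nested:
  assumes "a < c" "c < d" "d < b" "b < h"
  shows "\<exists>f. pattern_embedding h {(a, b), (c, d)} n S f"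
proof -
  define g where "g i = (if i < a then i else if i = a then x else if i < c then x + i
    else if i = c then w else if i < d then w + i else if i = d then y else z i)" for i
  have "strict_mono_on {..<h} g"
  proof (rule strict_mono_onI)
    fix i j assume "i \<in> {..<h}" "j \<in> {..<h}" "i < j"
    then show "g i < g j"
      using leaf_bounds[of i] leaf_bounds[of j] leaf_less[of i j] by (auto simp: g_def)
  qed
  moreover have "g i < n" if "i < h" for i
    using leaf_bounds[OF that] by (auto simp: g_def)
  ultimately have "pattern_embedding h {(a, b), (c, d)} n S g"
    using assms arcs(3) arcs(4)[of b] by (intro pattern_embedding_mono) (auto simp: g_def)
  then show ?thesis by blast
qed

text \<open>
  Vertex \<open>b\<close> moves to the front of \<open>a\<close>.  The back edge \<open>ab\<close> disappears, and \<open>b\<close> is now the centre of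
  a star with leaves \<open>d\<close> and the vertices strictly between \<open>a\<close> and \<open>b\<close>.
\<close>

lemma embeds_path:
  assumes "a < b" "b < d" "d < h"
  shows "\<exists>f. pattern_embedding h {(a, b), (b, d)} n S f"
proof -
  define g where "g i = (if i < a then i else if i = a then y else z i)" for i
  have "strict_mono_on {..<h} g"
  proof (rule strict_mono_onI)
    fix i j assume "i \<in> {..<h}" "j \<in> {..<h}" "i < j"
    then show "g i < g j"
      using leaf_bounds[of i] leaf_bounds[of j] leaf_less[of i j] by (auto simp: g_def)
  qed
  moreover have "g i < n" if "i < h" for i
    using leaf_bounds[OF that] by (auto simp: g_def)
  moreover have "g i < x" if "i < a" for i
    using leaf_bounds[of i] that assms by (auto simp: g_def)
  ultimately have "pattern_embedding h {(a, b), (b, d)} n S (g(b := x))"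
    using assms leaf_bounds[of a] arcs(4)
    by (intro pattern_embedding_shift[where l = a]) (auto simp: g_def)
  then show ?thesis by blast
qed

text \<open>
  Vertex \<open>c\<close> moves to the front of \<open>b\<close>.  Then \<open>c\<close> is joined to \<open>d\<close> and to \<open>b, \<dots>, c - 1\<close>, and the
  remaining back edge \<open>ab\<close> meets this star in its first leaf \<open>b\<close>, with \<open>a\<close> before \<open>c\<close>: the role of
  the edge \<open>uy\<close> in the double star.
\<close>

lemma embeds_separated:
  assumes "a < b" "b < c" "c < d" "d < h"
  shows "\<exists>f. pattern_embedding h {(a, b), (c, d)} n S f"
proof -
  define g where "g i = (if i < a then i else if i = a then u else if i < b then u + i
    else if i = b then y else z i)" for i
  have "strict_mono_on {..<h} g"
  proof (rule strict_mono_onI)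
    fix i j assume "i \<in> {..<h}" "j \<in> {..<h}" "i < j"
    then show "g i < g j"
      using leaf_bounds[of i] leaf_bounds[of j] leaf_less[of i j] by (auto simp: g_def)
  qed
  moreover have "g i < n" if "i < h" for i
    using leaf_bounds[OF that] by (auto simp: g_def)
  moreover have "g i < x" if "i < b" for i
    using leaf_bounds[of i] that assms by (auto simp: g_def)
  ultimately have "pattern_embedding h {(a, b), (c, d)} n S (g(c := x))"
    using assms leaf_bounds[of b] arcs(1,2,4)
    by (intro pattern_embedding_shift[where l = b]) (auto simp: g_def)
  then show ?thesis by blast
qed

lemma embeds_pair:
  assumes "a < b" "b < h" "c < d" "d < h"
  shows "\<exists>f. pattern_embedding h {(a, b), (c, d)} n S f"
proof -
  have *: "\<exists>f. pattern_embedding h {(a, b), (c, d)} n S f"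
    if "a < b" "b < h" "c < d" "d < h" "a \<le> c" for a b c d
  proof -
    consider "a = c" "b \<le> d" | "a = c" "d \<le> b" | "b < c" | "b = c"
      | "a < c" "c < b" "b \<le> d" | "a < c" "d < b"
      using \<open>a \<le> c\<close> by linarith
    then show ?thesis
      using that embeds_star[of a b d] embeds_star[of a d b] embeds_separated[of a b c d]
        embeds_path[of a b d] embeds_crossing[of a c b d] embeds_nested[of a c d b]
      by cases (simp_all add: insert_commute)
  qed
  show ?thesis
    using *[of a b c d] *[of c d a b] assms by (metis insert_commute nat_le_linear)
qed

text \<open>A single back edge is treated as a pair of equal ones.\<close>

lemma embeds_at_most_two:
  assumes B: "B \<subseteq> {(i, j). i < j \<and> j < h}" and card: "card B \<le> 2"
  shows "\<exists>f. pattern_embedding h B n S f"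
proof (cases "B = {}")
  case True
  have "i < n" if "i < h" for i
    using leaf_bounds[OF that] by linarith
  then have "pattern_embedding h B n S (\<lambda>i. i)"
    by (intro pattern_embedding_mono) (simp_all add: True strict_mono_on_def)
  then show ?thesis by blast
next
  case False
  have "finite B"
    using B by (rule finite_subset) (auto intro: finite_subset[of _ "{..<h} \<times> {..<h}"])
  with False card have "card B = 1 \<or> card B = 2"
    by (metis One_nat_def Suc_1 card_0_eq le_SucE le_zero_eq)
  then have "\<exists>p q. B = {p, q}"
    by (metis card_1_singletonE card_2_iff insert_absorb2)
  then obtain p q where pq: "B = {p, q}" by blast
  obtain a b c d where "p = (a, b)" "q = (c, d)" by force
  with B pq embeds_pair[of a b c d] show ?thesis by auto
qed

end

section \<open>From vertex orders to copies of a tournament\<close>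

lemma min_feedback_attained:
  assumes "finite (pverts H)"
  obtains r where "linear_order_on (pverts H) r"
    "card (back_edge_graph H r) = min_feedback H"
proof -
  obtain r where "well_order_on (pverts H) r"
    using well_order_on by blast
  then have "linear_order_on (pverts H) r"
    by (simp add: well_order_on_def)
  then have "\<exists>k r. linear_order_on (pverts H) r \<and> card (back_edge_graph H r) = k"
    by blast
  from LeastI_ex[OF this] show ?thesis
    unfolding min_feedback_def[symmetric] using that by blast
qed

text \<open>The position of a vertex is the number of its strict predecessors.\<close>

lemma linear_order_on_position:
  assumes "finite V" and r: "linear_order_on V r"
  obtains pos :: "'a \<Rightarrow> nat" where "inj_on pos V" "\<And>v. v \<in> V \<Longrightarrow> pos v < card V"
    "\<And>v w. v \<in> V \<Longrightarrow> w \<in> V \<Longrightarrow> (v, w) \<in> r \<longleftrightarrow> pos v \<le> pos w"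
proof -
  define pos where "pos v = card {u \<in> V. u \<noteq> v \<and> (u, v) \<in> r}" for v
  have refl: "(v, v) \<in> r" if "v \<in> V" for v
    using r that by (auto simp: order_on_defs refl_on_def)
  have total: "(v, w) \<in> r \<or> (w, v) \<in> r" if "v \<in> V" "w \<in> V" for v w
    using r that refl by (cases "v = w") (auto simp: order_on_defs total_on_def)
  have less: "pos v < pos w" if "v \<in> V" "w \<in> V" "(v, w) \<in> r" "v \<noteq> w" for v w
  proof -
    have "trans r" "antisym r" using r by (auto simp: order_on_defs)
    then have "{u \<in> V. u \<noteq> v \<and> (u, v) \<in> r} \<subset> {u \<in> V. u \<noteq> w \<and> (u, w) \<in> r}"
      using that by (auto dest: transD antisymD)
    then show ?thesis
      unfolding pos_def using \<open>finite V\<close> by (intro psubset_card_mono) auto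
  qed
  have iff: "(v, w) \<in> r \<longleftrightarrow> pos v \<le> pos w" if "v \<in> V" "w \<in> V" for v w
    using less[of v w] less[of w v] refl[of v] total[of v w] that
    by (cases "v = w") force+
  have "inj_on pos V"
    using less total by (intro inj_onI) (metis less_irrefl)
  moreover have "pos v < card V" if "v \<in> V" for v
    unfolding pos_def using that \<open>finite V\<close> by (intro psubset_card_mono) auto
  ultimately show ?thesis using that iff by blast
qed

lemma contains_copy_add_reverses:
  fixes H :: "'a pair_pre_digraph"
  assumes H: "tournament H" and r: "linear_order_on (pverts H) r"
    and two: "card (back_edge_graph H r) \<le> 2"
    and S: "S \<subseteq> parcs (transitive_tournament n)"
    and star: "spread_double_star (card (pverts H)) n S u x w y z"
  shows "contains_copy (add_reverses (transitive_tournament n) S) H"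
proof -
  interpret H: pair_digraph H
    using H by (simp add: tournament_def)
  interpret spread_double_star "card (pverts H)" n S u x w y z by fact
  let ?h = "card (pverts H)" and ?D = "add_reverses (transitive_tournament n) S"
  have arcs_D: "parcs ?D = {(i, j). i < j \<and> j < n} \<union> S\<inverse>" and verts_D: "pverts ?D = {..<n}"
    by (auto simp: add_reverses_def transitive_tournament_def)
  have S': "S \<subseteq> {(i, j). i < j \<and> j < n}"
    using S by (simp add: transitive_tournament_def)
  have wf: "pair_wf_digraph ?D"
    using S' by unfold_locales (auto simp: arcs_D verts_D)
  obtain pos where inj: "inj_on pos (pverts H)"
    and lt: "\<And>v. v \<in> pverts H \<Longrightarrow> pos v < ?h"
    and le: "\<And>v w. v \<in> pverts H \<Longrightarrow> w \<in> pverts H \<Longrightarrow> (v, w) \<in> r \<longleftrightarrow> pos v \<le> pos w"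
    using linear_order_on_position[OF H.finite_verts r] by blast
  define B where "B = (\<lambda>(v, w). (pos w, pos v)) ` back_edges H r"
  have back_less: "v \<in> pverts H \<and> w \<in> pverts H \<and> pos w < pos v" if "(v, w) \<in> back_edges H r" for v w
  proof -
    have vw: "(v, w) \<in> parcs H" "(w, v) \<in> r"
      using that by (auto simp: back_edges_def)
    moreover have "v \<in> pverts H" "w \<in> pverts H" "v \<noteq> w"
      using H.in_arcsD1[OF vw(1)] H.in_arcsD2[OF vw(1)] H.no_loops'[OF vw(1)] by blast+
    moreover from this have "pos v \<noteq> pos w"
      using inj by (auto dest: inj_onD)
    ultimately show ?thesis
      using le[of w v] by auto
  qed
  have B: "B \<subseteq> {(i, j). i < j \<and> j < ?h}"
  proof
    fix e assume "e \<in> B"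
    then obtain v w where "e = (pos w, pos v)" "(v, w) \<in> back_edges H r"
      by (auto simp: B_def)
    with back_less[of v w] lt[of v] show "e \<in> {(i, j). i < j \<and> j < ?h}"
      by simp
  qed
  \<comment> \<open>An undirected back edge determines its pair of positions, so \<open>B\<close> is no larger than the
      back-edge graph.\<close>
  have "B = (\<lambda>e. (Min (pos ` e), Max (pos ` e))) ` back_edge_graph H r"
    unfolding B_def back_edge_graph_def image_image
  proof (rule image_cong)
    fix e assume e: "e \<in> back_edges H r"
    obtain v w where vw: "e = (v, w)" by force
    have "pos w < pos v"
      using back_less[of v w] e vw by blast
    then have "Min (pos ` {v, w}) = pos w" "Max (pos ` {v, w}) = pos v"
      by (auto intro!: Min_eqI Max_eqI)
    then show "(case e of (v, w) \<Rightarrow> (pos w, pos v)) =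
        (Min (pos ` (case e of (i, j) \<Rightarrow> {i, j})), Max (pos ` (case e of (i, j) \<Rightarrow> {i, j})))"
      by (simp only: vw prod.case)
  qed simp
  moreover have "back_edges H r \<subseteq> parcs H"
    by (auto simp: back_edges_def)
  then have "finite (back_edge_graph H r)"
    unfolding back_edge_graph_def by (intro finite_imageI finite_subset[OF _ H.finite_arcs])
  ultimately have "card B \<le> card (back_edge_graph H r)"
    using card_image_le by simp
  then have "card B \<le> 2"
    using two by simp
  from embeds_at_most_two[OF B this] obtain f where f: "pattern_embedding ?h B n S f"
    by blast
  then have f_less: "f i < n" if "i < ?h" for i
    using that by (simp add: pattern_embedding_def)
  have f_forward: "f i < f j \<or> (f j, f i) \<in> S" if "i < j" "j < ?h" "(i, j) \<notin> B" for i j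
    using f that by (simp add: pattern_embedding_def)
  have f_backward: "f j < f i \<or> (f i, f j) \<in> S" if "i < j" "j < ?h" "(i, j) \<in> B" for i j
    using f that by (simp add: pattern_embedding_def)
  have "f i \<noteq> f j" if "i < j" "j < ?h" for i j
    using f_forward[OF that] f_backward[OF that] S' by (cases "(i, j) \<in> B") auto
  then have f_inj: "inj_on f {..<?h}"
    by (intro linorder_inj_onI) auto
  have "pos ` pverts H \<subseteq> {..<?h}"
    using lt by auto
  then have "inj_on (f \<circ> pos) (pverts H)"
    by (intro comp_inj_on[OF inj] inj_on_subset[OF f_inj])
  moreover have "(f \<circ> pos) ` pverts H \<subseteq> pverts ?D"
    using f_less lt by (auto simp: verts_D)
  moreover have "((f \<circ> pos) v, (f \<circ> pos) w) \<in> parcs ?D" if vw: "(v, w) \<in> parcs H" for v w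
  proof -
    have V: "v \<in> pverts H" "w \<in> pverts H" "v \<noteq> w"
      using H.in_arcsD1[OF vw] H.in_arcsD2[OF vw] H.no_loops'[OF vw] by blast+
    then have "pos v \<noteq> pos w"
      using inj by (auto dest: inj_onD)
    then consider "pos v < pos w" | "pos w < pos v" by linarith
    then show ?thesis
    proof cases
      case 1
      have "(pos v, pos w) \<notin> B"
      proof
        assume "(pos v, pos w) \<in> B"
        then obtain p q where pq: "(p, q) \<in> back_edges H r" "pos q = pos v" "pos p = pos w"
          by (auto simp: B_def)
        then have "q = v" "p = w"
          using back_less[OF pq(1)] V inj_onD[OF inj pq(2)] inj_onD[OF inj pq(3)] by blast+
        with pq have "(w, v) \<in> parcs H" by (simp add: back_edges_def)
        moreover have "((v, w) \<in> parcs H) \<noteq> ((w, v) \<in> parcs H)"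
          using H V unfolding tournament_def by blast
        ultimately show False
          using vw by blast
      qed
      then show ?thesis
        using f_forward[OF 1 lt[OF V(2)]] f_less[OF lt[OF V(2)]] by (auto simp: arcs_D)
    next
      case 2
      then have "(v, w) \<in> back_edges H r"
        using vw le V by (simp add: back_edges_def)
      then have "(pos w, pos v) \<in> B" by (force simp: B_def)
      then show ?thesis
        using f_backward[OF 2 lt[OF V(1)]] f_less[OF lt[OF V(2)]] by (auto simp: arcs_D)
    qed
  qed
  ultimately show ?thesis
    using contains_copy_iff[OF wf H.pair_wf_digraph_axioms] by blast
qed

section \<open>The linear bound\<close>

text \<open>
  For small \<open>n\<close> the transitive tournament has fewer than \<open>C * n + 1\<close> arcs; the property defining
  the edge-adding number then holds vacuously at \<open>C * n + 1\<close>, so one bound serves all \<open>n\<close>.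
\<close>

theorem theorem5:
  fixes H :: "'a pair_pre_digraph"
  assumes "tournament H" and "min_feedback H \<le> 2"
  shows "(\<lambda>n. real (edge_adding_number (transitive_tournament n) H)) \<in> O(\<lambda>n. real n)"
proof -
  interpret H: pair_digraph H
    using assms(1) by (simp add: tournament_def)
  let ?h = "card (pverts H)"
  let ?C = "Suc ?h * Suc ?h + 2 * (Suc ?h * 2)"
  obtain r where r: "linear_order_on (pverts H) r" "card (back_edge_graph H r) \<le> 2"
    using min_feedback_attained[OF H.finite_verts] assms(2) by metis
  have "edge_adding_number (transitive_tournament n) H \<le> Suc (?C * n)" for n
    unfolding edge_adding_number_def
  proof (rule Least_le, intro allI impI)
    fix S assume S: "S \<subseteq> parcs (transitive_tournament n)" and card: "card S = Suc (?C * n)"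
    have "\<exists>u x w y z. spread_double_star ?h n S u x w y z"
      using S card by (intro ex_spread_double_star) (simp_all add: transitive_tournament_def)
    then show "contains_copy (add_reverses (transitive_tournament n) S) H"
      using contains_copy_add_reverses[OF assms(1) r S] by blast
  qed
  then have bound: "real (edge_adding_number (transitive_tournament n) H) \<le> real (Suc ?C) * real n"
    if "n \<ge> 1" for n
  proof -
    have "edge_adding_number (transitive_tournament n) H \<le> Suc ?C * n"
      using \<open>\<And>n. edge_adding_number (transitive_tournament n) H \<le> Suc (?C * n)\<close>[of n] that
      by simp
    then show ?thesis
      by (metis of_nat_le_iff of_nat_mult)
  qed
  show ?thesis
    by (rule bigoI[of _ "real (Suc ?C)"])
      (use bound in \<open>auto intro!: eventually_mono[OF eventually_ge_at_top[of 1]]\<close>)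
qed

end
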